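(* Let $\{G_n\}_{n \in \mathbb{N}}$ be groups and let $\phi: \prod_{n \in \mathbb{N}} G_n/\mathcal{U} \to H$ be an abstract group homomorphism, where $\mathcal{U}$ is a nonprincipal ultrafilter on $\mathbb{N}$ and $H$ is a residually (bounded torsion) group with $|H| < 2^{\aleph_0}$. Then every abelian subgroup of the image of $\phi$ is bounded torsion.
   Context: A group $K$ is bounded torsion if there exists an integer $n \geq 1$ such that $g^n = 1$ for all $g \in K$. A group $H$ is residually (bounded torsion) if for every $g \in H \setminus \{1\}$ there exists a normal subgroup $L \unlhd H$ with $g \notin L$ and $H/L$ bounded torsion. An ultrafilter $\mathcal{U}$ on a set $I$ is nonprincipal if $\{x\} \notin \mathcal{U}$ for each $x \in I$. The ultraproduct $\prod_{i \in I} G_i/\mathcal{U}$ is the quotient of $\prod_{i \in I} G_i$ by the normal subgroup $\{(g_i)_{i \in I} \mid \{i \in I \mid g_i = 1\} \in \mathcal{U}\}$. *)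

theory Defs
  imports "HOL-Algebra.Algebra" "HOL-Library.Equipollence"
begin

definition bounded_torsion :: "('a, 'b) monoid_scheme \<Rightarrow> bool"
  where "bounded_torsion K \<longleftrightarrow>
    (\<exists>n::nat. n \<ge> 1 \<and> (\<forall>g \<in> carrier K. g [^]\<^bsub>K\<^esub> n = \<one>\<^bsub>K\<^esub>))"

definition residually_bounded_torsion :: "('a, 'b) monoid_scheme \<Rightarrow> bool"
  where "residually_bounded_torsion H \<longleftrightarrow>
    (\<forall>g \<in> carrier H - {\<one>\<^bsub>H\<^esub>}. \<exists>L. L \<lhd> H \<and> g \<notin> L \<and> bounded_torsion (H Mod L))"

(* A filter on a set is represented by the library type of filters: the set {i. P i} belongs
   to U iff "eventually P U".  That type includes the improper filter bot. *)

definition ultrafilter :: "'i filter \<Rightarrow> bool"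
  where "ultrafilter U \<longleftrightarrow>
    U \<noteq> bot \<and> (\<forall>P. eventually P U \<or> eventually (\<lambda>i. \<not> P i) U)"

definition nonprincipal :: "'i filter \<Rightarrow> bool"
  where "nonprincipal U \<longleftrightarrow> (\<forall>x. \<not> eventually (\<lambda>i. i \<in> {x}) U)"

definition ultraproduct_kernel ::
    "('i \<Rightarrow> ('a, 'b) monoid_scheme) \<Rightarrow> 'i filter \<Rightarrow> ('i \<Rightarrow> 'a) set"
  where "ultraproduct_kernel G U =
    {g \<in> carrier (product_group UNIV G). eventually (\<lambda>i. g i = \<one>\<^bsub>G i\<^esub>) U}"

definition ultraproduct ::
    "('i \<Rightarrow> ('a, 'b) monoid_scheme) \<Rightarrow> 'i filter \<Rightarrow> ('i \<Rightarrow> 'a) set monoid"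
  where "ultraproduct G U = product_group UNIV G Mod ultraproduct_kernel G U"

lemma ultraproduct_kernel_normal:
  assumes G: "\<And>i. group (G i)"
  shows "ultraproduct_kernel G U \<lhd> product_group UNIV G"
proof -
  interpret P: group "product_group UNIV G"
    using G by simp
  have sub: "subgroup (ultraproduct_kernel G U) (product_group UNIV G)"
  proof (rule P.subgroupI)
    show "ultraproduct_kernel G U \<subseteq> carrier (product_group UNIV G)"
      by (auto simp: ultraproduct_kernel_def)
    have "\<one>\<^bsub>product_group UNIV G\<^esub> \<in> ultraproduct_kernel G U"
      using P.one_closed by (simp add: ultraproduct_kernel_def)
    then show "ultraproduct_kernel G U \<noteq> {}"
      by blast
  next
    fix a assume "a \<in> ultraproduct_kernel G U"
    then have a: "a \<in> carrier (product_group UNIV G)" "eventually (\<lambda>i. a i = \<one>\<^bsub>G i\<^esub>) U"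
      by (auto simp: ultraproduct_kernel_def)
    have "eventually (\<lambda>i. inv\<^bsub>G i\<^esub> a i = \<one>\<^bsub>G i\<^esub>) U"
      using a(2) by eventually_elim (simp add: G group.is_monoid monoid.inv_one)
    then show "inv\<^bsub>product_group UNIV G\<^esub> a \<in> ultraproduct_kernel G U"
      using a(1) P.inv_closed[OF a(1)] G by (simp add: ultraproduct_kernel_def)
  next
    fix a b assume "a \<in> ultraproduct_kernel G U" "b \<in> ultraproduct_kernel G U"
    then have a: "a \<in> carrier (product_group UNIV G)" "eventually (\<lambda>i. a i = \<one>\<^bsub>G i\<^esub>) U"
      and b: "b \<in> carrier (product_group UNIV G)" "eventually (\<lambda>i. b i = \<one>\<^bsub>G i\<^esub>) U"
      by (auto simp: ultraproduct_kernel_def)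
    have "eventually (\<lambda>i. a i \<otimes>\<^bsub>G i\<^esub> b i = \<one>\<^bsub>G i\<^esub>) U"
      using a(2) b(2) by eventually_elim (simp add: G group.is_monoid monoid.l_one monoid.one_closed)
    then show "a \<otimes>\<^bsub>product_group UNIV G\<^esub> b \<in> ultraproduct_kernel G U"
      using P.m_closed[OF a(1) b(1)] by (simp add: ultraproduct_kernel_def)
  qed
  show ?thesis
    unfolding P.normal_inv_iff
    proof (intro conjI sub ballI)
      fix x h assume x: "x \<in> carrier (product_group UNIV G)" and "h \<in> ultraproduct_kernel G U"
      then have h: "h \<in> carrier (product_group UNIV G)" "eventually (\<lambda>i. h i = \<one>\<^bsub>G i\<^esub>) U"
        by (auto simp: ultraproduct_kernel_def)
      have xi: "x i \<in> carrier (G i)" for i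
        using x by auto
      have "eventually (\<lambda>i. x i \<otimes>\<^bsub>G i\<^esub> h i \<otimes>\<^bsub>G i\<^esub> inv\<^bsub>G i\<^esub> x i = \<one>\<^bsub>G i\<^esub>) U"
        using h(2) by eventually_elim (simp add: G xi group.is_monoid monoid.r_one group.r_inv)
      moreover have "x \<otimes>\<^bsub>product_group UNIV G\<^esub> h \<otimes>\<^bsub>product_group UNIV G\<^esub>
          inv\<^bsub>product_group UNIV G\<^esub> x \<in> carrier (product_group UNIV G)"
        by (intro P.m_closed P.inv_closed x h(1))
      ultimately show "x \<otimes>\<^bsub>product_group UNIV G\<^esub> h \<otimes>\<^bsub>product_group UNIV G\<^esub>
          inv\<^bsub>product_group UNIV G\<^esub> x \<in> ultraproduct_kernel G U"
        using x G by (simp add: ultraproduct_kernel_def)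
    qed
qed

lemma group_ultraproduct:
  assumes "\<And>i. group (G i)"
  shows "group (ultraproduct G U)"
  unfolding ultraproduct_def
  by (rule normal.factorgroup_is_group[OF ultraproduct_kernel_normal[OF assms]])

end

theory Submission
  imports Defs
begin

text \<open>
  Suppose the abelian subgroup \<open>A\<close> of the image of \<open>\<phi>\<close> is not bounded torsion.  The idea is to
  produce pairwise distinct elements of \<open>H\<close>, one for each \<open>S \<subseteq> \<nat>\<close>, as images of formally infinite
  nested powers
  \<open>x\<^sub>0 (x\<^sub>1 (x\<^sub>2 (\<dots>)^m\<^sub>2)^m\<^sub>1)^m\<^sub>0\<close>.

  Such expressions make sense in an ultraproduct over \<open>\<nat>\<close>: truncate the nesting at depth \<open>n\<close> in the
  \<open>n\<close>-th factor.  The recursion \<open>y\<^sub>j = x\<^sub>j y\<^sub>j\<^sub>+\<^sub>1 ^ m\<^sub>j\<close> then holds in all but finitely many factors,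
  hence in the ultraproduct (\<open>ultraproduct_nested_power_system\<close>).  Taking for \<open>x\<^sub>j\<close> a preimage of
  \<open>a\<^sub>j\<close> or of \<open>1\<close> according to whether \<open>j \<in> S\<close>, the images \<open>c\<^sub>j = \<phi> y\<^sub>j\<close> satisfy the same
  recursion in \<open>H\<close>.

  The elements \<open>a\<^sub>j\<close> of \<open>A\<close>, the normal subgroups \<open>L\<^sub>j\<close> and the exponents \<open>m\<^sub>j\<close> of \<open>H / L\<^sub>j\<close> are
  chosen successively: with \<open>p\<^sub>j = m\<^sub>0 \<dots> m\<^sub>j\<^sub>-\<^sub>1\<close>, unboundedness of \<open>A\<close> gives \<open>a\<^sub>j\<close> with
  \<open>a\<^sub>j ^ p\<^sub>j \<noteq> 1\<close>, and residual bounded torsion gives \<open>L\<^sub>j\<close> avoiding this power.  Modulo \<open>L\<^sub>i\<close> the tail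
  \<open>c\<^sub>i\<^sub>+\<^sub>1 ^ m\<^sub>i\<close> vanishes, so \<open>c\<^sub>0\<close> becomes a finite nested power of elements of \<open>A\<close>.  As \<open>A\<close> is abelian,
  this power expands to a factor depending only on \<open>S \<inter> {0..<i}\<close>, times \<open>a\<^sub>i ^ p\<^sub>i\<close> if \<open>i \<in> S\<close>
  (\<open>nested_power_expansion\<close>).  Two sets whose first difference is \<open>i\<close> therefore give different values
  of \<open>c\<^sub>0\<close> modulo \<open>L\<^sub>i\<close> (\<open>nested_power_sequences_differ\<close>), which contradicts the bound on the
  cardinality of \<open>H\<close>.
\<close>

section \<open>Infinite nested powers in ultraproducts\<close>

text \<open>
  Unfolding from \<open>j\<close>, this is \<open>x\<^sub>j (x\<^sub>j\<^sub>+\<^sub>1 (\<dots>)^m\<^sub>j\<^sub>+\<^sub>1)^m\<^sub>j\<close> cut off after \<open>k\<close> levels.  The index \<open>j\<close> grows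
  as \<open>k\<close> shrinks, so that the same cut-off position \<open>j + k\<close> is shared by an expression and its tail.
\<close>

primrec nested_power ::
    "('a, 'b) monoid_scheme \<Rightarrow> (nat \<Rightarrow> 'a) \<Rightarrow> (nat \<Rightarrow> nat) \<Rightarrow> nat \<Rightarrow> nat \<Rightarrow> 'a"
where
  "nested_power G x m 0 j = \<one>\<^bsub>G\<^esub>"
| "nested_power G x m (Suc k) j = x j \<otimes>\<^bsub>G\<^esub> nested_power G x m k (Suc j) [^]\<^bsub>G\<^esub> m j"

lemma (in monoid) nested_power_closed:
  assumes "\<And>j. x j \<in> carrier G"
  shows "nested_power G x m k j \<in> carrier G"
  by (induction k arbitrary: j) (simp_all add: assms)

lemma product_group_nat_pow:
  assumes "\<And>i. group (G i)" and "f \<in> carrier (product_group UNIV G)"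
  shows "(f [^]\<^bsub>product_group UNIV G\<^esub> (k::nat)) i = f i [^]\<^bsub>G i\<^esub> k"
  by (induction k) simp_all

lemma nonprincipal_ultrafilter_eventually_gt:
  fixes U :: "nat filter"
  assumes "ultrafilter U" and "nonprincipal U"
  shows "eventually (\<lambda>n. j < n) U"
proof -
  have "eventually (\<lambda>n. n \<noteq> i) U" for i
    using assms by (auto simp: ultrafilter_def nonprincipal_def)
  then have "eventually (\<lambda>n. \<forall>i\<in>{..j}. n \<noteq> i) U"
    by (intro eventually_ball_finite) auto
  then show ?thesis
    by eventually_elim (metis atMost_iff not_le_imp_less)
qed

lemma ultraproduct_coset_eqI:
  assumes G: "\<And>i. group (G i)"
    and f: "f \<in> carrier (product_group UNIV G)" and g: "g \<in> carrier (product_group UNIV G)"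
    and eq: "eventually (\<lambda>i. f i = g i) U"
  shows "ultraproduct_kernel G U #>\<^bsub>product_group UNIV G\<^esub> f
       = ultraproduct_kernel G U #>\<^bsub>product_group UNIV G\<^esub> g"
proof -
  interpret P: group "product_group UNIV G"
    using G by simp
  interpret N: normal "ultraproduct_kernel G U" "product_group UNIV G"
    by (rule ultraproduct_kernel_normal[OF G])
  have gi: "g i \<in> carrier (G i)" for i
    using g by auto
  have "eventually (\<lambda>i. f i \<otimes>\<^bsub>G i\<^esub> inv\<^bsub>G i\<^esub> g i = \<one>\<^bsub>G i\<^esub>) U"
    using eq by eventually_elim (simp add: G gi group.r_inv)
  then have "f \<otimes>\<^bsub>product_group UNIV G\<^esub> inv\<^bsub>product_group UNIV G\<^esub> g \<in> ultraproduct_kernel G U"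
    using P.m_closed[OF f P.inv_closed[OF g]] g G by (simp add: ultraproduct_kernel_def)
  then have "f \<in> ultraproduct_kernel G U #>\<^bsub>product_group UNIV G\<^esub> g"
    using f g N.is_subgroup N.rcos_module_rev P.is_group by blast
  then show ?thesis
    using g N.is_subgroup P.repr_independence by metis
qed

text \<open>
  An infinite triangular system of equations is solvable in the ultraproduct although it need not be
  solvable in any factor: the \<open>n\<close>-th factor only has to satisfy the equations with index below \<open>n\<close>,
  and a finite nested power does this.  Each single equation then fails in finitely many factors only.
\<close>

lemma ultraproduct_nested_power_system:
  fixes G :: "nat \<Rightarrow> ('a, 'b) monoid_scheme"
  assumes G: "\<And>n. group (G n)"
    and U: "\<And>j. eventually (\<lambda>n. j < n) U"
    and x: "\<And>j. x j \<in> carrier (ultraproduct G U)"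
  shows "\<exists>y. (\<forall>j. y j \<in> carrier (ultraproduct G U)) \<and>
    (\<forall>j. y j = x j \<otimes>\<^bsub>ultraproduct G U\<^esub> y (Suc j) [^]\<^bsub>ultraproduct G U\<^esub> (m j :: nat))"
proof -
  let ?P = "product_group UNIV G" and ?N = "ultraproduct_kernel G U"
  interpret P: group ?P
    using G by simp
  interpret N: normal ?N ?P
    by (rule ultraproduct_kernel_normal[OF G])
  interpret Q: group "ultraproduct G U"
    by (rule group_ultraproduct[OF G])
  interpret pr: group_hom ?P "ultraproduct G U" "\<lambda>f. ?N #>\<^bsub>?P\<^esub> f"
    using N.r_coset_hom_Mod
    by unfold_locales (simp add: ultraproduct_def)
  have "\<exists>f. f \<in> carrier ?P \<and> x j = ?N #>\<^bsub>?P\<^esub> f" for j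
    using x[of j] by (auto simp: ultraproduct_def FactGroup_def RCOSETS_def)
  then obtain f where f: "\<And>j. f j \<in> carrier ?P" and xf: "\<And>j. x j = ?N #>\<^bsub>?P\<^esub> f j"
    by metis
  \<comment> \<open>Depth \<open>n - j\<close> places the cut-off at position \<open>n\<close> for every \<open>j\<close>; for \<open>j \<ge> n\<close> the value is \<open>1\<close>.\<close>
  define w where "w j n = nested_power (G n) (\<lambda>i. f i n) m (n - j) j" for j n
  have fn: "f j n \<in> carrier (G n)" for j n
    using f[of j] by auto
  have "w j n \<in> carrier (G n)" for j n
    unfolding w_def using G fn by (intro monoid.nested_power_closed) (auto simp: group.is_monoid)
  then have w: "w j \<in> carrier ?P" for j
    by (simp add: PiE_iff)
  show ?thesis
  proof (intro exI[of _ "\<lambda>j. ?N #>\<^bsub>?P\<^esub> w j"] conjI allI)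
    show "?N #>\<^bsub>?P\<^esub> w j \<in> carrier (ultraproduct G U)" for j
      using w by (rule pr.hom_closed)
    show "?N #>\<^bsub>?P\<^esub> w j = x j \<otimes>\<^bsub>ultraproduct G U\<^esub>
        (?N #>\<^bsub>?P\<^esub> w (Suc j)) [^]\<^bsub>ultraproduct G U\<^esub> m j" for j
    proof -
      have "eventually (\<lambda>n. w j n = (f j \<otimes>\<^bsub>?P\<^esub> w (Suc j) [^]\<^bsub>?P\<^esub> m j) n) U"
        using U[of j]
      proof eventually_elim
        case (elim n)
        then have "n - j = Suc (n - Suc j)"
          by simp
        then show ?case
          by (simp add: w_def[of j] product_group_nat_pow[OF G w]) (simp add: w_def)
      qed
      then have "?N #>\<^bsub>?P\<^esub> w j = ?N #>\<^bsub>?P\<^esub> (f j \<otimes>\<^bsub>?P\<^esub> w (Suc j) [^]\<^bsub>?P\<^esub> m j)"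
        using G f w by (intro ultraproduct_coset_eqI P.m_closed P.nat_pow_closed)
      also have "\<dots> = x j \<otimes>\<^bsub>ultraproduct G U\<^esub>
          (?N #>\<^bsub>?P\<^esub> w (Suc j)) [^]\<^bsub>ultraproduct G U\<^esub> m j"
        using f w by (simp only: pr.hom_mult pr.hom_nat_pow P.nat_pow_closed xf)
      finally show ?thesis .
    qed
  qed
qed

section \<open>Nested powers modulo normal subgroups of bounded exponent\<close>

lemma bounded_torsion_quotientE:
  assumes "L \<lhd> H" and "bounded_torsion (H Mod L)"
  obtains n :: nat where "n \<ge> 1" and "\<And>x. x \<in> carrier H \<Longrightarrow> L #>\<^bsub>H\<^esub> (x [^]\<^bsub>H\<^esub> n) = \<one>\<^bsub>H Mod L\<^esub>"
proof -
  interpret L: normal L H by fact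
  interpret Q: group "H Mod L" by (rule L.factorgroup_is_group)
  interpret pr: group_hom H "H Mod L" "\<lambda>x. L #>\<^bsub>H\<^esub> x"
    using L.r_coset_hom_Mod by unfold_locales
  obtain n :: nat where n: "n \<ge> 1" "\<And>g. g \<in> carrier (H Mod L) \<Longrightarrow> g [^]\<^bsub>H Mod L\<^esub> n = \<one>\<^bsub>H Mod L\<^esub>"
    using assms(2) by (auto simp: bounded_torsion_def)
  show thesis
    by (rule that[OF n(1)]) (use n(2) in \<open>simp only: pr.hom_nat_pow pr.hom_closed\<close>)
qed

text \<open>
  Up to the kernel of \<open>h\<close>, the first term of a nested power sequence whose \<open>i\<close>-th term is \<open>a \<in> A\<close> can
  be computed inside \<open>A\<close>, where powers of products may be expanded.  The order of quantifiers is what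
  matters: the factor \<open>t\<close> depends on \<open>b 0, \<dots>, b (i - 1)\<close> only, so it is common to all sequences
  that share these coefficients.  In the induction step, the \<open>i\<close>-th term is \<open>b i \<otimes> a [^] m i\<close> up to
  the kernel, which is again an element of \<open>A\<close>.
\<close>

lemma (in group_hom) nested_power_expansion:
  fixes m :: "nat \<Rightarrow> nat"
  assumes A: "subgroup A G"
    and comm: "comm_group (G\<lparr>carrier := A\<rparr>)"
    and b: "\<And>j. j < i \<Longrightarrow> b j \<in> A"
  shows "\<exists>t\<in>A. \<forall>a c. a \<in> A \<longrightarrow> (\<forall>j. c j \<in> carrier G) \<longrightarrow>
          (\<forall>j<i. c j = b j \<otimes> c (Suc j) [^] m j) \<longrightarrow> h (c i) = h a \<longrightarrow>
          h (c 0) = h (t \<otimes> a [^] (\<Prod>j<i. m j))"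
proof -
  interpret A: subgroup A G by fact
  have pow: "a [^] n \<in> A" if "a \<in> A" for a and n :: nat
    using that by (induction n) simp_all
  show ?thesis
    using b
  proof (induction i)
    case 0
    show ?case
      by (rule bexI[of _ \<one>]) auto
  next
    case (Suc i)
    let ?p = "\<Prod>j<i. m j"
    obtain t where t: "t \<in> A" and IH: "\<And>a c. a \<in> A \<Longrightarrow> (\<And>j. c j \<in> carrier G) \<Longrightarrow>
          (\<And>j. j < i \<Longrightarrow> c j = b j \<otimes> c (Suc j) [^] m j) \<Longrightarrow> h (c i) = h a \<Longrightarrow>
          h (c 0) = h (t \<otimes> a [^] ?p)"
      using Suc by (metis less_SucI)
    have bi: "b i \<in> A"
      using Suc.prems by simp
    show ?case
    proof (intro bexI[of _ "t \<otimes> b i [^] ?p"] allI impI)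
      show "t \<otimes> b i [^] ?p \<in> A"
        using t bi pow by simp
      fix a c
      assume a: "a \<in> A" and c: "\<forall>j. c j \<in> carrier G"
        and rec: "\<forall>j<Suc i. c j = b j \<otimes> c (Suc j) [^] m j" and hc: "h (c (Suc i)) = h a"
      have carr: "a \<in> carrier G" "b i \<in> carrier G" "t \<in> carrier G"
        using a bi t A.subset by auto
      have am: "a [^] m i \<in> A"
        using a by (rule pow)
      have "c i = b i \<otimes> c (Suc i) [^] m i"
        using rec by blast
      then have "h (c i) = h (b i) \<otimes>\<^bsub>H\<^esub> h (c (Suc i)) [^]\<^bsub>H\<^esub> m i"
        using c carr by (simp only: hom_mult hom_nat_pow G.nat_pow_closed)
      also have "\<dots> = h (b i \<otimes> a [^] m i)"
        using carr by (simp add: hc hom_nat_pow)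
      finally have "h (c 0) = h (t \<otimes> (b i \<otimes> a [^] m i) [^] ?p)"
        using IH[of "b i \<otimes> a [^] m i" c] A.m_closed[OF bi am] c rec less_SucI by blast
      also have "(b i \<otimes> a [^] m i) [^] ?p = b i [^] ?p \<otimes> (a [^] m i) [^] ?p"
        using comm_groupE(4)[OF comm] bi am carr by (intro G.pow_mult_distrib) simp_all
      also have "(a [^] m i) [^] ?p = a [^] (\<Prod>j<Suc i. m j)"
        using carr by (simp add: G.nat_pow_pow mult.commute)
      finally show "h (c 0) = h (t \<otimes> b i [^] ?p \<otimes> a [^] (\<Prod>j<Suc i. m j))"
        using carr by (simp add: G.m_assoc)
    qed
  qed
qed

text \<open>
  Since \<open>m i\<close> is an exponent of \<open>H / L\<close>, everything beyond position \<open>i\<close> is invisible modulo \<open>L\<close>: the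
  \<open>i\<close>-th terms are \<open>a\<close> and \<open>\<one>\<close> there.  With a common factor \<open>t\<close> the first terms are then \<open>t\<close> times
  \<open>a [^] (\<Prod>j<i. m j)\<close> and \<open>t\<close>, which the hypothesis on \<open>L\<close> separates.
\<close>

lemma nested_power_sequences_differ:
  fixes m :: "nat \<Rightarrow> nat" and i :: nat
  assumes "group H" and A: "subgroup A H"
    and comm: "comm_group (H\<lparr>carrier := A\<rparr>)"
    and L: "L \<lhd> H" and exp: "\<And>x. x \<in> carrier H \<Longrightarrow> L #>\<^bsub>H\<^esub> (x [^]\<^bsub>H\<^esub> m i) = \<one>\<^bsub>H Mod L\<^esub>"
    and a: "a \<in> A" and notin: "a [^]\<^bsub>H\<^esub> (\<Prod>j<i. m j) \<notin> L"
    and b: "\<And>j. b j \<in> A" and agree: "\<And>j. j < i \<Longrightarrow> b' j = b j"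
    and bi: "b i = a" and b'i: "b' i = \<one>\<^bsub>H\<^esub>"
    and c: "\<And>j. c j \<in> carrier H" and c': "\<And>j. c' j \<in> carrier H"
    and rec: "\<And>j. c j = b j \<otimes>\<^bsub>H\<^esub> c (Suc j) [^]\<^bsub>H\<^esub> m j"
    and rec': "\<And>j. c' j = b' j \<otimes>\<^bsub>H\<^esub> c' (Suc j) [^]\<^bsub>H\<^esub> m j"
  shows "c 0 \<noteq> c' 0"
proof
  assume eq: "c 0 = c' 0"
  interpret L: normal L H by fact
  interpret Q: group "H Mod L" by (rule L.factorgroup_is_group)
  interpret pr: group_hom H "H Mod L" "\<lambda>x. L #>\<^bsub>H\<^esub> x"
    using L.r_coset_hom_Mod by unfold_locales
  interpret A: subgroup A H by fact
  obtain t where t: "t \<in> A"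
    and expand: "\<forall>a c. a \<in> A \<longrightarrow> (\<forall>j. c j \<in> carrier H) \<longrightarrow>
          (\<forall>j<i. c j = b j \<otimes>\<^bsub>H\<^esub> c (Suc j) [^]\<^bsub>H\<^esub> m j) \<longrightarrow>
          L #>\<^bsub>H\<^esub> c i = L #>\<^bsub>H\<^esub> a \<longrightarrow>
          L #>\<^bsub>H\<^esub> c 0 = L #>\<^bsub>H\<^esub> (t \<otimes>\<^bsub>H\<^esub> a [^]\<^bsub>H\<^esub> (\<Prod>j<i. m j))"
    using pr.nested_power_expansion[of A i b m, OF A comm b] by (elim bexE)
  let ?p = "\<Prod>j<i. m j"
  have carr: "a \<in> carrier H" "t \<in> carrier H"
    using a t A.subset by auto
  have "L #>\<^bsub>H\<^esub> c i = (L #>\<^bsub>H\<^esub> b i) \<otimes>\<^bsub>H Mod L\<^esub> (L #>\<^bsub>H\<^esub> (c (Suc i) [^]\<^bsub>H\<^esub> m i))"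
    using rec[of i] c bi carr by (metis L.nat_pow_closed pr.hom_mult)
  then have "L #>\<^bsub>H\<^esub> c i = L #>\<^bsub>H\<^esub> a"
    using exp[OF c] carr by (simp only: bi Q.r_one pr.hom_closed)
  then have "L #>\<^bsub>H\<^esub> c 0 = L #>\<^bsub>H\<^esub> (t \<otimes>\<^bsub>H\<^esub> a [^]\<^bsub>H\<^esub> ?p)"
    using expand[rule_format, of a c] a c rec by blast
  moreover have "L #>\<^bsub>H\<^esub> c' i = L #>\<^bsub>H\<^esub> \<one>\<^bsub>H\<^esub>"
    using rec'[of i] exp[OF c'] c' by (metis L.l_one L.nat_pow_closed b'i pr.hom_one)
  then have "L #>\<^bsub>H\<^esub> c' 0 = L #>\<^bsub>H\<^esub> (t \<otimes>\<^bsub>H\<^esub> \<one>\<^bsub>H\<^esub> [^]\<^bsub>H\<^esub> ?p)"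
    using expand[rule_format, of "\<one>\<^bsub>H\<^esub>" c'] A.one_closed c' rec' agree by metis
  ultimately have "(L #>\<^bsub>H\<^esub> t) \<otimes>\<^bsub>H Mod L\<^esub> (L #>\<^bsub>H\<^esub> (a [^]\<^bsub>H\<^esub> ?p)) = L #>\<^bsub>H\<^esub> t"
    using eq carr by simp
  then have "L #>\<^bsub>H\<^esub> (a [^]\<^bsub>H\<^esub> ?p) = \<one>\<^bsub>H Mod L\<^esub>"
    using carr by (metis L.nat_pow_closed Q.l_cancel_one pr.hom_closed)
  then have "a [^]\<^bsub>H\<^esub> ?p \<in> L"
    using carr L.rcos_self[OF _ L.is_subgroup] by (metis L.nat_pow_closed one_FactGroup)
  with notin show False ..
qed

section \<open>Abelian subgroups of the image\<close>

theorem theorem16: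
  fixes G :: "nat \<Rightarrow> ('a, 'b) monoid_scheme"
    and U :: "nat filter"
    and H :: "('c, 'd) monoid_scheme"
    and \<phi> :: "(nat \<Rightarrow> 'a) set \<Rightarrow> 'c"
    and A :: "'c set"
  assumes "\<And>n. group (G n)"
    and "ultrafilter U" and "nonprincipal U"
    and "group H"
    and "residually_bounded_torsion H"
    and "carrier H \<prec> Pow (UNIV :: nat set)"
    and "\<phi> \<in> hom (ultraproduct G U) H"
    and "subgroup A (H\<lparr>carrier := \<phi> ` carrier (ultraproduct G U)\<rparr>)"
    and "comm_group (H\<lparr>carrier := A\<rparr>)"
  shows "bounded_torsion (H\<lparr>carrier := A\<rparr>)"
proof (rule ccontr)
  assume unbounded: "\<not> bounded_torsion (H\<lparr>carrier := A\<rparr>)"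
  note gt = nonprincipal_ultrafilter_eventually_gt[OF assms(2,3)]
  interpret H: group H by fact
  interpret Q: group "ultraproduct G U"
    by (rule group_ultraproduct[OF assms(1)])
  interpret phi: group_hom "ultraproduct G U" H \<phi>
    using assms(7) by unfold_locales
  have A: "subgroup A H"
    using H.incl_subgroup[OF phi.img_is_subgroup assms(8)] .
  have A_img: "A \<subseteq> \<phi> ` carrier (ultraproduct G U)"
    using subgroup.subset[OF assms(8)] by simp
  have "\<exists>a L m. a \<in> A \<and> L \<lhd> H \<and> a [^]\<^bsub>H\<^esub> p \<notin> L \<and> m \<ge> 1 \<and>
      (\<forall>x\<in>carrier H. L #>\<^bsub>H\<^esub> (x [^]\<^bsub>H\<^esub> (m::nat)) = \<one>\<^bsub>H Mod L\<^esub>)" if p: "p \<ge> 1" for p :: nat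
  proof -
    obtain a where a: "a \<in> A" "a [^]\<^bsub>H\<^esub> p \<noteq> \<one>\<^bsub>H\<^esub>"
      using unbounded p by (auto simp: bounded_torsion_def simp flip: H.nat_pow_consistent)
    then have "a [^]\<^bsub>H\<^esub> p \<in> carrier H - {\<one>\<^bsub>H\<^esub>}"
      using subgroup.subset[OF A] by auto
    then obtain L where L: "L \<lhd> H" "a [^]\<^bsub>H\<^esub> p \<notin> L" "bounded_torsion (H Mod L)"
      using assms(5) unfolding residually_bounded_torsion_def by blast
    show ?thesis
      using bounded_torsion_quotientE[OF L(1,3)] a L by metis
  qed
  then obtain a L m where sel: "\<And>p::nat. p \<ge> 1 \<Longrightarrow> a p \<in> A \<and> L p \<lhd> H \<and> a p [^]\<^bsub>H\<^esub> p \<notin> L p \<and>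
      m p \<ge> 1 \<and> (\<forall>x\<in>carrier H. L p #>\<^bsub>H\<^esub> (x [^]\<^bsub>H\<^esub> (m p::nat)) = \<one>\<^bsub>H Mod L p\<^esub>)"
    by metis
  \<comment> \<open>The triple \<open>a p\<close>, \<open>L p\<close>, \<open>m p\<close> depends on \<open>p\<close> alone, so iterating \<open>p \<mapsto> p * m p\<close> makes each
    exponent the product of all earlier values of \<open>m\<close> without a dependent choice of the triples.\<close>
  define p where "p = rec_nat 1 (\<lambda>_ q. q * m q)"
  have p_simps: "p 0 = 1" "p (Suc i) = p i * m (p i)" for i
    by (simp_all add: p_def)
  have p_prod: "p i = (\<Prod>j<i. m (p j))" for i
    by (induction i) (simp_all add: p_simps)
  have p_pos: "p i \<ge> 1" for i
  proof (induction i)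
    case (Suc i)
    then show ?case
      using sel[OF Suc] by (simp add: p_simps)
  qed (simp add: p_simps)
  note sel = sel[OF p_pos]
  define b where "b S j = (if j \<in> S then a (p j) else \<one>\<^bsub>H\<^esub>)" for S j
  have b: "b S j \<in> A" for S j
    using sel subgroup.one_closed[OF A] by (simp add: b_def)
  have "\<exists>c. (\<forall>j. c j \<in> carrier H) \<and>
      (\<forall>j. c j = b S j \<otimes>\<^bsub>H\<^esub> c (Suc j) [^]\<^bsub>H\<^esub> m (p j))" for S
  proof -
    have "\<exists>x. x \<in> carrier (ultraproduct G U) \<and> \<phi> x = b S j" for j
      using b[of S j] A_img by force
    then obtain x where x: "\<And>j. x j \<in> carrier (ultraproduct G U)" and xb: "\<And>j. \<phi> (x j) = b S j"
      by metis
    obtain y where y: "\<forall>j. y j \<in> carrier (ultraproduct G U)"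
      and rec: "\<forall>j. y j = x j \<otimes>\<^bsub>ultraproduct G U\<^esub> y (Suc j) [^]\<^bsub>ultraproduct G U\<^esub> m (p j)"
      using ultraproduct_nested_power_system[of G U x "\<lambda>j. m (p j)", OF assms(1) gt x]
      by (elim exE conjE)
    have "\<phi> (y j) = b S j \<otimes>\<^bsub>H\<^esub> \<phi> (y (Suc j)) [^]\<^bsub>H\<^esub> m (p j)" for j
      by (subst rec[rule_format]) (simp add: x y xb phi.hom_nat_pow)
    then show ?thesis
      using phi.hom_closed y by (intro exI[of _ "\<lambda>j. \<phi> (y j)"]) blast
  qed
  then obtain c where c: "\<And>S j. c S j \<in> carrier H"
    and rec: "\<And>S j. c S j = b S j \<otimes>\<^bsub>H\<^esub> c S (Suc j) [^]\<^bsub>H\<^esub> m (p j)"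
    by metis
  have differ: "c S 0 \<noteq> c T 0"
    if "i \<in> S" "i \<notin> T" and below: "\<And>j. j < i \<Longrightarrow> j \<in> S \<longleftrightarrow> j \<in> T" for S T i
  proof (rule nested_power_sequences_differ[where i = i and a = "a (p i)" and L = "L (p i)"
        and m = "\<lambda>j. m (p j)" and b = "b S" and b' = "b T", OF assms(4) A assms(9)])
    show "a (p i) [^]\<^bsub>H\<^esub> (\<Prod>j<i. m (p j)) \<notin> L (p i)"
      using sel[of i] by (simp flip: p_prod)
    show "b S j \<in> A" "c S j \<in> carrier H" "c T j \<in> carrier H"
      "c S j = b S j \<otimes>\<^bsub>H\<^esub> c S (Suc j) [^]\<^bsub>H\<^esub> m (p j)"
      "c T j = b T j \<otimes>\<^bsub>H\<^esub> c T (Suc j) [^]\<^bsub>H\<^esub> m (p j)" for j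
      by (fact b c rec)+
  qed (use sel[of i] that in \<open>auto simp: b_def\<close>)
  have "inj (\<lambda>S. c S 0)"
  proof (rule injI, rule ccontr)
    fix S T assume eq: "c S 0 = c T 0" and "S \<noteq> T"
    then have ex: "\<exists>i. \<not> (i \<in> S \<longleftrightarrow> i \<in> T)"
      by blast
    define i where "i = (LEAST i. \<not> (i \<in> S \<longleftrightarrow> i \<in> T))"
    have i: "\<not> (i \<in> S \<longleftrightarrow> i \<in> T)"
      unfolding i_def by (rule LeastI_ex[OF ex])
    have below: "j \<in> S \<longleftrightarrow> j \<in> T" if "j < i" for j
      using not_less_Least that unfolding i_def by blast
    show False
      using i below eq differ[of i S T] differ[of i T S] by metis
  qed
  then have "Pow (UNIV :: nat set) \<lesssim> carrier H"
    using c by (auto simp: lepoll_def)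
  then show False
    using assms(6) lesspoll_trans2 by blast
qed

end
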